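(* Let $Q$ be a nondegenerate indefinite (real) quadratic form on $\mathbb{R}^n$ with $n\ge 3$. Then $Q$ admits a fully supported isotropic vector, i.e. there exists $x=(x_1,\dots,x_n)^\top\in\mathbb{R}^n$ with $Q(x)=0$ and $x_i\neq 0$ for every $i=1,\dots,n$.
   Context: A quadratic form $Q:\mathbb{R}^n\to\mathbb{R}$ is indefinite if it attains both positive and negative values; it is nondegenerate if the radical of its associated symmetric bilinear form is zero, equivalently if the symmetric matrix representing $Q$ is nonsingular. A vector $x$ is isotropic if $Q(x)=0$. A vector is fully supported if all of its coordinates (with respect to the standard basis) are nonzero. *)

theory Defs
  imports "HOL-Analysis.Analysis"
begin

text \<open>The symmetric bilinear form associated with \<open>Q\<close>, normalised so that
  \<open>assoc_form Q x x = Q x\<close>.\<close>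

definition assoc_form :: "('a::real_vector \<Rightarrow> real) \<Rightarrow> 'a \<Rightarrow> 'a \<Rightarrow> real" where
  "assoc_form Q x y = (Q (x + y) - Q x - Q y) / 2"

definition quadratic_form :: "('a::real_vector \<Rightarrow> real) \<Rightarrow> bool" where
  "quadratic_form Q \<longleftrightarrow>
     (\<forall>c x. Q (c *\<^sub>R x) = c\<^sup>2 * Q x) \<and> bilinear (assoc_form Q)"

definition radical :: "('a::real_vector \<Rightarrow> real) \<Rightarrow> 'a set" where
  "radical Q = {x. \<forall>y. assoc_form Q x y = 0}"

definition nondegenerate :: "('a::real_vector \<Rightarrow> real) \<Rightarrow> bool" where
  "nondegenerate Q \<longleftrightarrow> radical Q = {0}"

definition indefinite :: "('a::real_vector \<Rightarrow> real) \<Rightarrow> bool" where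
  "indefinite Q \<longleftrightarrow> (\<exists>x. Q x > 0) \<and> (\<exists>x. Q x < 0)"

definition isotropic :: "('a::real_vector \<Rightarrow> real) \<Rightarrow> 'a \<Rightarrow> bool" where
  "isotropic Q x \<longleftrightarrow> Q x = 0"

definition fully_supported :: "real ^ 'n \<Rightarrow> bool" where
  "fully_supported x \<longleftrightarrow> (\<forall>i. x $ i \<noteq> 0)"

text \<open>Agreement with the matrix description of quadratic forms.\<close>

lemma assoc_form_matrix:
  fixes A :: "real ^ 'n ^ 'n"
  assumes "transpose A = A"
  shows "assoc_form (\<lambda>x. x \<bullet> (A *v x)) x y = x \<bullet> (A *v y)"
proof -
  have "y \<bullet> (A *v x) = x \<bullet> (A *v y)"
    by (metis assms dot_lmul_matrix inner_commute transpose_matrix_vector)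
  then show ?thesis
    by (simp add: assoc_form_def matrix_vector_right_distrib inner_add_left inner_add_right)
qed

lemma quadratic_form_matrix:
  fixes A :: "real ^ 'n ^ 'n"
  assumes "transpose A = A"
  shows "quadratic_form (\<lambda>x. x \<bullet> (A *v x))"
proof -
  have "bilinear (assoc_form (\<lambda>x. x \<bullet> (A *v x)))"
    unfolding bilinear_def assoc_form_matrix[OF assms, abs_def]
    by (auto intro!: linearI simp: matrix_vector_right_distrib matrix_vector_mult_scaleR
        inner_add_left inner_add_right)
  then show ?thesis
    by (simp add: quadratic_form_def matrix_vector_mult_scaleR power2_eq_square)
qed

lemma quadratic_form_iff_matrix:
  fixes Q :: "real ^ 'n \<Rightarrow> real"
  shows "quadratic_form Q \<longleftrightarrow> (\<exists>A. transpose A = A \<and> Q = (\<lambda>x. x \<bullet> (A *v x)))"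
proof
  assume Q: "quadratic_form Q"
  define B where "B = assoc_form Q"
  define A :: "real ^ 'n ^ 'n" where "A = (\<chi> i j. B (axis i 1) (axis j 1))"
  have bil: "bilinear B" using Q by (simp add: quadratic_form_def B_def)
  have sym: "B x y = B y x" for x y by (simp add: B_def assoc_form_def add.commute)
  have "transpose A = A"
    by (simp add: A_def transpose_def vec_eq_iff) (metis sym)
  moreover have "Q x = x \<bullet> (A *v x)" for x
  proof -
    have "Q (2 *\<^sub>R x) = 4 * Q x" using Q by (simp add: quadratic_form_def)
    then have "Q x = B x x" by (simp add: B_def assoc_form_def scaleR_2)
    also have "\<dots> = B (\<Sum>i\<in>UNIV. x $ i *s axis i 1) (\<Sum>j\<in>UNIV. x $ j *s axis j 1)"
      by (simp only: basis_expansion)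
    also have "\<dots> = (\<Sum>i\<in>UNIV. \<Sum>j\<in>UNIV. x $ i * (x $ j * A $ i $ j))"
      by (simp add: bilinear_sum[OF bil] sum.cartesian_product
          scalar_mult_eq_scaleR bilinear_lmul[OF bil] bilinear_rmul[OF bil] A_def mult.left_commute)
    also have "\<dots> = x \<bullet> (A *v x)"
      by (simp add: inner_vec_def matrix_vector_mult_def sum_distrib_left algebra_simps)
    finally show ?thesis .
  qed
  ultimately show "\<exists>A. transpose A = A \<and> Q = (\<lambda>x. x \<bullet> (A *v x))" by blast
next
  assume "\<exists>A. transpose A = A \<and> Q = (\<lambda>x. x \<bullet> (A *v x))"
  then show "quadratic_form Q" using quadratic_form_matrix by blast
qed

lemma nondegenerate_iff_invertible:
  fixes A :: "real ^ 'n ^ 'n"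
  assumes "transpose A = A"
  shows "nondegenerate (\<lambda>x. x \<bullet> (A *v x)) \<longleftrightarrow> invertible A"
proof -
  have "x \<in> radical (\<lambda>x. x \<bullet> (A *v x)) \<longleftrightarrow> A *v x = 0" for x
  proof -
    have "x \<bullet> (A *v y) = (A *v x) \<bullet> y" for y
      by (metis assms dot_lmul_matrix transpose_matrix_vector)
    then show ?thesis
      by (simp add: radical_def assoc_form_matrix[OF assms])
  qed
  then have "radical (\<lambda>x. x \<bullet> (A *v x)) = {x. A *v x = 0}" by blast
  then have "nondegenerate (\<lambda>x. x \<bullet> (A *v x)) \<longleftrightarrow> (\<forall>x. A *v x = 0 \<longrightarrow> x = 0)"
    by (auto simp: nondegenerate_def)
  then show ?thesis
    by (metis invertible_left_inverse matrix_left_invertible_ker)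
qed

end

theory Submission
  imports Defs "HOL-Computational_Algebra.Polynomial"
begin

text \<open>For an isotropic \<open>v\<close> and any \<open>w\<close>, the vector \<open>Q w v - 2 B(v, w) w\<close> is isotropic, being \<open>Q w\<close>
  times the reflection of \<open>v\<close> along \<open>w\<close> when \<open>Q w \<noteq> 0\<close>. Its coordinates are quadratic polynomials
  in \<open>w\<close>. None of them vanishes identically: otherwise \<open>Q w v\<^sub>i = 2 B(v, w) w\<^sub>i\<close> for all \<open>w\<close>, so \<open>Q\<close>
  would have rank at most 2 (if \<open>v\<^sub>i \<noteq> 0\<close>) or \<open>v\<close> would lie in the radical (if \<open>v\<^sub>i = 0\<close>). Hence some
  \<open>w\<close> makes all coordinates nonzero at once.\<close>

text \<open>Induction on \<open>I\<close>: join a point good for \<open>I\<close> to a point good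
  for \<open>j\<close>. On this line every \<open>f i\<close> is a nonzero polynomial in the
  parameter, so only finitely many parameters are bad.\<close>

lemma common_nonzero_of_poly_on_lines:
  fixes f :: "'i \<Rightarrow> 'a::real_vector \<Rightarrow> real"
  assumes "finite I"
    and line: "\<And>i w u. i \<in> I \<Longrightarrow> \<exists>p. \<forall>t. f i (w + t *\<^sub>R u) = poly p t"
    and nz: "\<And>i. i \<in> I \<Longrightarrow> \<exists>w. f i w \<noteq> 0"
  shows "\<exists>w. \<forall>i\<in>I. f i w \<noteq> 0"
  using assms
proof (induction I rule: finite_induct)
  case empty
  then show ?case by simp
next
  case (insert j I)
  obtain w0 where w0: "\<forall>i\<in>I. f i w0 \<noteq> 0"
    using insert.IH insert.prems by auto
  obtain w1 where w1: "f j w1 \<noteq> 0"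
    using insert.prems(2) by blast
  have "finite {t. f i (w0 + t *\<^sub>R (w1 - w0)) = 0}" if i: "i \<in> insert j I" for i
  proof -
    obtain p where p: "\<forall>t. f i (w0 + t *\<^sub>R (w1 - w0)) = poly p t"
      using insert.prems(1) i by blast
    \<comment> \<open>The value at 0 is nonzero for \<open>i\<close> in \<open>I\<close>, the value
      at 1 for \<open>i = j\<close>.\<close>
    have "poly p 0 = f i w0" "poly p 1 = f i w1"
      using p[rule_format, of 0] p[rule_format, of 1] by simp_all
    then have "p \<noteq> 0"
      using i w0 w1 by auto
    then show ?thesis
      by (simp add: p poly_roots_finite)
  qed
  then have "finite (\<Union>i\<in>insert j I. {t. f i (w0 + t *\<^sub>R (w1 - w0)) = 0})"
    using insert.hyps by blast
  then obtain t where "t \<notin> (\<Union>i\<in>insert j I. {t. f i (w0 + t *\<^sub>R (w1 - w0)) = 0})"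
    using ex_new_if_finite[OF infinite_UNIV_char_0] by blast
  then show ?case by blast
qed

text \<open>Otherwise \<open>(f, g)\<close> would embed the space linearly into a plane.\<close>

lemma two_functionals_common_zero:
  fixes f g :: "'a::euclidean_space \<Rightarrow> real"
  assumes "DIM('a) \<ge> 3" "linear f" "linear g"
  shows "\<exists>w. w \<noteq> 0 \<and> f w = 0 \<and> g w = 0"
proof (rule ccontr)
  assume no: "\<not> ?thesis"
  define h where "h = (\<lambda>w. (f w, g w))"
  have "linear h"
    using assms(2,3) by (auto intro!: linearI simp: h_def linear_add linear_scale)
  moreover from this no have "inj h"
    by (auto simp: linear_injective_0 h_def zero_prod_def)
  ultimately have "dim (h ` UNIV) = DIM('a)"
    by (simp add: dim_image_eq)
  moreover have "dim (h ` UNIV) \<le> DIM(real \<times> real)"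
    by (rule dim_subset_UNIV)
  ultimately show False
    using assms(1) by simp
qed

context
  fixes Q :: "'a::real_vector \<Rightarrow> real"
  assumes Q: "quadratic_form Q"
begin

lemma assoc_form_bilinear: "bilinear (assoc_form Q)"
  and quadratic_form_scaleR: "Q (c *\<^sub>R x) = c\<^sup>2 * Q x"
  using Q by (simp_all add: quadratic_form_def)

lemma assoc_form_commute: "assoc_form Q x y = assoc_form Q y x"
  by (simp add: assoc_form_def add.commute)

lemma quadratic_form_add: "Q (x + y) = Q x + 2 * assoc_form Q x y + Q y"
  by (simp add: assoc_form_def field_simps)

lemma quadratic_form_line:
  "Q (x + t *\<^sub>R y) = Q x + 2 * t * assoc_form Q x y + t\<^sup>2 * Q y"
  by (simp add: quadratic_form_add quadratic_form_scaleR bilinear_rmul[OF assoc_form_bilinear])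

lemma isotropic_reflection:
  assumes "isotropic Q v"
  shows "isotropic Q (Q w *\<^sub>R v - (2 * assoc_form Q v w) *\<^sub>R w)"
proof -
  \<comment> \<open>The cross term \<open>- 4 * Q w * (assoc_form Q v w)\<^sup>2\<close> cancels the
    square term.\<close>
  have "Q (Q w *\<^sub>R v + (- (2 * assoc_form Q v w)) *\<^sub>R w) = 0"
    using assms unfolding quadratic_form_line
    by (simp add: isotropic_def quadratic_form_scaleR
        bilinear_lmul[OF assoc_form_bilinear] power2_eq_square)
  then show ?thesis
    by (simp add: isotropic_def)
qed

text \<open>Along a line from a positive vector in a negative direction, \<open>Q\<close> is a
  quadratic polynomial whose constant and leading coefficients have opposite signs, so it has a real
  root.\<close>

lemma indefinite_nonzero_isotropic:
  assumes "indefinite Q"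
  shows "\<exists>v. v \<noteq> 0 \<and> isotropic Q v"
proof -
  obtain x y where x: "Q x > 0" and y: "Q y < 0"
    using assms by (auto simp: indefinite_def)
  define b where "b = assoc_form Q x y"
  define s where "s = sqrt (b\<^sup>2 - Q x * Q y)"
  \<comment> \<open>A root of \<open>Q y * t\<^sup>2 + 2 * b * t + Q x\<close> by the quadratic
    formula.\<close>
  define t where "t = (s - b) / Q y"
  have "Q x * Q y \<le> 0"
    using x y by (simp add: mult_le_0_iff)
  then have "0 \<le> b\<^sup>2 - Q x * Q y"
    using zero_le_power2[of b] by linarith
  then have s: "s\<^sup>2 = b\<^sup>2 - Q x * Q y"
    by (simp add: s_def)
  have "t * Q y = s - b"
    using y by (simp add: t_def)
  then have "Q y * Q (x + t *\<^sub>R y) = Q x * Q y + 2 * (s - b) * b + (s - b)\<^sup>2"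
    unfolding quadratic_form_line b_def[symmetric]
    by (simp add: power2_eq_square algebra_simps flip: \<open>t * Q y = s - b\<close>)
  also have "\<dots> = 0"
    using s by (simp add: power2_eq_square algebra_simps)
  finally have "isotropic Q (x + t *\<^sub>R y)"
    using y by (simp add: isotropic_def)
  moreover have "x + t *\<^sub>R y \<noteq> 0"
  \<comment> \<open>Proportional vectors cannot have values of \<open>Q\<close> of strictly opposite
    signs.\<close>
  proof
    assume "x + t *\<^sub>R y = 0"
    then have "x = (- t) *\<^sub>R y"
      by (simp add: eq_neg_iff_add_eq_0)
    then have "Q x = t\<^sup>2 * Q y"
      using quadratic_form_scaleR[of "- t" y] by simp
    then show False
      using x y by (metis mult_nonneg_nonpos less_imp_le not_le zero_le_power2)
  qed
  ultimately show ?thesis by blast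
qed

end

lemma reflection_coordinate_nonzero:
  fixes Q :: "real ^ 'n \<Rightarrow> real"
  assumes card: "CARD('n) \<ge> 3" and Q: "quadratic_form Q" and "nondegenerate Q" and "v \<noteq> 0"
  shows "\<exists>w. Q w * v $ i - 2 * assoc_form Q v w * w $ i \<noteq> 0"
proof (rule ccontr)
  define B where "B = assoc_form Q"
  note bil = assoc_form_bilinear[OF Q, folded B_def]
  assume "\<not> ?thesis"
  then have eq: "Q w * v $ i = 2 * B v w * w $ i" for w
    by (simp add: B_def)
  \<comment> \<open>Polarization of \<open>eq\<close>.\<close>
  have polar: "B w u * v $ i = B v w * u $ i + B v u * w $ i" for w u
    using eq[of "w + u"] eq[of w] eq[of u] assoc_form_commute[OF Q, of w u, folded B_def]
    by (simp add: quadratic_form_add[OF Q, folded B_def] bilinear_radd[OF bil] algebra_simps)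
  have nondeg: "\<exists>u. B w u \<noteq> 0" if "w \<noteq> 0" for w
    using \<open>nondegenerate Q\<close> that by (auto simp: nondegenerate_def radical_def B_def)
  show False
  proof (cases "v $ i = 0")
    case True
    have "B v (axis i 1) = 0"
      using polar[of "axis i 1" "axis i 1"] True by simp
    then have "B v w = 0" for w
      using polar[of w "axis i 1"] True by simp
    then show False
      using nondeg \<open>v \<noteq> 0\<close> by blast
  next
    case False
    have "linear (B v)" "linear (\<lambda>w. w $ i)"
      using bil by (auto simp: bilinear_def intro: linearI)
    \<comment> \<open>Such a \<open>w\<close> makes the right side of \<open>polar\<close> vanish
      for every \<open>u\<close>, so it lies in the radical. Dimension at least 3 enters
      here.\<close>
    then obtain w where "w \<noteq> 0" "B v w = 0" "w $ i = 0"
      using two_functionals_common_zero[of "B v" "\<lambda>w. w $ i"] card by auto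
    then show False
      using nondeg[of w] polar[of w] False by auto
  qed
qed

theorem proposition2p5:
  fixes Q :: "real ^ 'n \<Rightarrow> real"
  assumes "CARD('n) \<ge> 3"
    and "quadratic_form Q"
    and "nondegenerate Q"
    and "indefinite Q"
  shows "\<exists>x. isotropic Q x \<and> fully_supported x"
proof -
  note Q = assms(2)
  obtain v where v: "v \<noteq> 0" "isotropic Q v"
    using indefinite_nonzero_isotropic[OF Q assms(4)] by blast
  define f where "f i w = Q w * v $ i - 2 * assoc_form Q v w * w $ i" for i w
  \<comment> \<open>Each \<open>f i\<close> is itself a quadratic form in \<open>w\<close>; the
    middle coefficient is twice its polar form at \<open>w\<close> and \<open>u\<close>.\<close>
  have line: "\<exists>p. \<forall>t. f i (w + t *\<^sub>R u) = poly p t" for i w u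
  proof (intro exI allI)
    fix t
    show "f i (w + t *\<^sub>R u) = poly [: f i w,
        2 * assoc_form Q w u * v $ i
          - 2 * (assoc_form Q v w * u $ i + assoc_form Q v u * w $ i), f i u :] t"
      by (simp add: f_def quadratic_form_line[OF Q] bilinear_radd[OF assoc_form_bilinear[OF Q]]
          bilinear_rmul[OF assoc_form_bilinear[OF Q]] power2_eq_square algebra_simps)
  qed
  have "\<exists>w. \<forall>i\<in>UNIV. f i w \<noteq> 0"
    using reflection_coordinate_nonzero[OF assms(1-3) v(1)]
    by (intro common_nonzero_of_poly_on_lines line) (simp_all add: f_def)
  then obtain w where "\<And>i. f i w \<noteq> 0"
    by blast
  then have "fully_supported (Q w *\<^sub>R v - (2 * assoc_form Q v w) *\<^sub>R w)"
    by (simp add: fully_supported_def f_def)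
  then show ?thesis
    using isotropic_reflection[OF Q v(2)] by blast
qed

end
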